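(* Let $H$ be a finite hypergraph as in the context and $x(n)$ the Pólya urn process on $H$. There exists a closed connected set $\mathscr J=\mathscr J(H)\subset\Delta^{m-1}$ contained in an affine subspace of $\mathbb R^m$ such that, almost surely, the limit set of $(x(n))_{n\ge0}$ (its set of accumulation points) is contained in $\mathscr J$. Moreover, if almost surely the limit set of $x(n)$ does not intersect $\partial\Delta^{m-1}=\{x\in\Delta^{m-1}:x_i=0\text{ for some } i\}$, then $x(n)$ converges almost surely to a (random) point of $\mathscr J$.
   Context: Let $H=(V,E)$ be a finite hypergraph with vertex set $V=[m]=\{1,\dots,m\}$ and a set $E$ of $N\ge 1$ hyperedges (nonempty subsets of $[m]$), such that every vertex belongs to at least one hyperedge. Pólya urn on $H$: initially vertex $i$ holds $B_i(0)\ge 1$ balls; $N_0=\sum_{i=1}^m B_i(0)$. At each step $n\ge 1$, for each hyperedge $I\in E$ (independently across hyperedges, conditionally on the past) one ball is added to a vertex $i\in I$ chosen with probability $B_i(n-1)/\sum_{j\in I}B_j(n-1)$, where $B_i(n)$ denotes the number of balls at vertex $i$ after step $n$. Put $x_i(n)=B_i(n)/(N_0+nN)$ and $x(n)=(x_1(n),\dots,x_m(n))$. $\Delta^{m-1}=\{x\in\mathbb R^m: x_i\ge 0,\ \sum_i x_i=1\}$. *)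

theory Defs
  imports "HOL-Probability.Probability"
begin

text \<open>Vertices are the elements of a finite type 'v; hyperedges form a set E of subsets.
  A ball configuration is a function 'v => nat.\<close>

definition edge_choice :: "('v \<Rightarrow> nat) \<Rightarrow> 'v set \<Rightarrow> 'v pmf" where
  "edge_choice b I = pmf_of_multiset (\<Sum>i\<in>I. replicate_mset (b i) i)"

definition urn_step :: "'v set set \<Rightarrow> ('v::finite \<Rightarrow> nat) \<Rightarrow> ('v \<Rightarrow> nat) pmf" where
  "urn_step E b = map_pmf (\<lambda>f. \<lambda>i. b i + card {I \<in> E. f I = i})
                          (Pi_pmf E undefined (\<lambda>I. edge_choice b I))"

text \<open>B is (a version of) the Polya urn process on the hypergraph with hyperedges E
  and initial configuration b0, defined on the probability space M: B 0 = b0 and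
  the process is a Markov chain with transition law urn_step E.\<close>
definition urn_process ::
  "'v set set \<Rightarrow> ('v::finite \<Rightarrow> nat) \<Rightarrow> 'w measure \<Rightarrow> (nat \<Rightarrow> 'w \<Rightarrow> ('v \<Rightarrow> nat)) \<Rightarrow> bool" where
  "urn_process E b0 M B \<longleftrightarrow>
     prob_space M \<and>
     (\<forall>n. B n \<in> measurable M (count_space UNIV)) \<and>
     (\<forall>\<omega>\<in>space M. B 0 \<omega> = b0) \<and>
     (\<forall>n h s. length h = Suc n \<longrightarrow>
        measure M {\<omega> \<in> space M. (\<forall>k\<le>n. B k \<omega> = h ! k) \<and> B (Suc n) \<omega> = s}
        = measure M {\<omega> \<in> space M. \<forall>k\<le>n. B k \<omega> = h ! k} * pmf (urn_step E (h ! n)) s)"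

definition urn_x :: "'v set set \<Rightarrow> ('v::finite \<Rightarrow> nat) \<Rightarrow> (nat \<Rightarrow> 'w \<Rightarrow> ('v \<Rightarrow> nat)) \<Rightarrow> 'w \<Rightarrow> nat \<Rightarrow> real ^ 'v" where
  "urn_x E b0 B \<omega> n = (\<chi> i. real (B n \<omega> i) / (real (sum b0 UNIV) + real n * real (card E)))"

definition std_simplex :: "(real ^ 'v::finite) set" where
  "std_simplex = {x. (\<forall>i. 0 \<le> x $ i) \<and> (\<Sum>i\<in>UNIV. x $ i) = 1}"

definition simplex_boundary :: "(real ^ 'v::finite) set" where
  "simplex_boundary = {x \<in> std_simplex. \<exists>i. x $ i = 0}"

definition limit_set :: "(nat \<Rightarrow> 'a::topological_space) \<Rightarrow> 'a set" where
  "limit_set f = {y. \<exists>r. strict_mono r \<and> (f \<circ> r) \<longlonglongrightarrow> y}"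

end

theory Submission
  imports Defs
begin

text \<open>
  Take for \<open>J\<close> the set of maximizers over the simplex of the product over the hyperedges \<open>I\<close> of
  \<open>x(I)\<close>, the sum of \<open>x\<^sub>i\<close> over \<open>i \<in> I\<close>. By strict concavity of the logarithm the numbers \<open>x(I)\<close> are
  the same for all maximizers, so \<open>J\<close> is the intersection of the simplex with an affine subspace.

  For \<open>p \<in> J\<close> let \<open>w\<^sub>p(n)\<close> be the sum of \<open>p\<^sub>i ln x\<^sub>i(n)\<close> over the vertices. Up to errors which are
  summable along every path (by telescoping \<open>1 / B\<^sub>i(n)\<close>) and a martingale whose variance is bounded
  by these same errors, \<open>w\<^sub>p\<close> increases by at least
  \<open>((\<Sum>I. p(I) / x(I)) - N) / T\<close>, with \<open>T\<close> the total number of balls, and this is at least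
  \<open>(\<Sum>I. ln p(I) - ln x(I)) / T \<ge> 0\<close>. As \<open>w\<^sub>p \<le> 0\<close>, almost surely \<open>w\<^sub>p\<close> converges for all \<open>p \<in> J\<close>
  simultaneously and these increments are summable. Since \<open>\<Sum> 1 / T = \<infinity>\<close>, the process has an
  accumulation point \<open>q \<in> J\<close>; then \<open>w\<^sub>q\<close> converges to the sum of \<open>q\<^sub>i ln q\<^sub>i\<close>, that is, the
  relative entropy of \<open>q\<close> with respect to \<open>x(n)\<close> tends to \<open>0\<close>, and \<open>x(n)\<close> converges to \<open>q\<close>.
\<close>

section \<open>Maximizers of the product of edge sums\<close>

text \<open>A product instead of the sum of the logarithms, so that it is continuous on the whole
  simplex, also where an edge sum vanishes.\<close>

definition edge_prod :: "'v set set \<Rightarrow> real ^ 'v::finite \<Rightarrow> real" where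
  "edge_prod E x = (\<Prod>I\<in>E. \<Sum>i\<in>I. x $ i)"

definition maximizers :: "'v set set \<Rightarrow> (real ^ 'v::finite) set" where
  "maximizers E = {p \<in> std_simplex. \<forall>x\<in>std_simplex. edge_prod E x \<le> edge_prod E p}"

lemma continuous_on_edge_prod: "continuous_on S (edge_prod E)"
  unfolding edge_prod_def by (intro continuous_intros)

section \<open>The standard simplex\<close>

lemma std_simplex_nonneg: "x \<in> std_simplex \<Longrightarrow> 0 \<le> x $ i"
  by (simp add: std_simplex_def)

lemma std_simplex_le_1: "x \<in> std_simplex \<Longrightarrow> x $ i \<le> 1"
  unfolding std_simplex_def using member_le_sum[of i UNIV "\<lambda>i. x $ i"] by auto

lemma closed_std_simplex: "closed (std_simplex :: (real ^ 'v::finite) set)"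
proof -
  have "std_simplex = (\<Inter>i. {x :: real ^ 'v. 0 \<le> x $ i}) \<inter> {x. (\<Sum>i\<in>UNIV. x $ i) = 1}"
    by (auto simp: std_simplex_def)
  also have "closed \<dots>"
    by (intro closed_INT closed_Int closed_Collect_le closed_Collect_eq continuous_intros ballI)
  finally show ?thesis .
qed

lemma compact_std_simplex: "compact (std_simplex :: (real ^ 'v::finite) set)"
proof -
  have "norm x \<le> 1" if "x \<in> std_simplex" for x :: "real ^ 'v"
    using norm_le_l1_cart[of x] that by (simp add: std_simplex_def)
  then have "bounded (std_simplex :: (real ^ 'v) set)"
    unfolding bounded_iff by blast
  with closed_std_simplex show ?thesis
    by (simp add: compact_eq_bounded_closed)
qed

lemma convex_std_simplex: "convex (std_simplex :: (real ^ 'v::finite) set)"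
  unfolding convex_def std_simplex_def
  by (auto simp: sum.distrib sum_distrib_left[symmetric])

text \<open>An interior point: it shows that the simplex is nonempty and bounds the maximum of
  \<open>edge_prod\<close> away from 0.\<close>

definition barycenter :: "real ^ 'v::finite" where
  "barycenter = (\<chi> i. 1 / real CARD('v))"

lemma barycenter: "barycenter \<in> std_simplex" "0 < barycenter $ i"
  by (auto simp: barycenter_def std_simplex_def)

section \<open>Existence and geometry of the maximizers\<close>

context
  fixes E :: "'v::finite set set"
  assumes nonempty: "\<forall>I\<in>E. I \<noteq> {}"
begin

lemma maximizers_nonempty: "maximizers E \<noteq> {}"
proof -
  obtain p :: "real ^ 'v"
    where "p \<in> std_simplex" "\<forall>x\<in>std_simplex. edge_prod E x \<le> edge_prod E p"
    using continuous_attains_sup[OF compact_std_simplex _ continuous_on_edge_prod] barycenter(1)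
    by (metis empty_iff)
  then show ?thesis
    by (auto simp: maximizers_def)
qed

text \<open>The maximum is at least the value at the barycenter, which is positive because edges are
  nonempty; so no factor vanishes.\<close>

lemma maximizers_edge_pos:
  assumes "p \<in> maximizers E" "I \<in> E"
  shows "0 < (\<Sum>i\<in>I. p $ i)"
proof -
  have "0 < edge_prod E barycenter"
    unfolding edge_prod_def using nonempty barycenter(2)
    by (intro prod_pos ballI sum_pos) auto
  also have "\<dots> \<le> edge_prod E p"
    using assms(1) barycenter(1) by (auto simp: maximizers_def)
  finally have "(\<Sum>i\<in>I. p $ i) \<noteq> 0"
    using assms(2) unfolding edge_prod_def by (metis finite less_irrefl prod_zero_iff)
  moreover have "0 \<le> (\<Sum>i\<in>I. p $ i)"
    using assms(1) by (auto simp: maximizers_def intro: sum_nonneg std_simplex_nonneg)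
  ultimately show ?thesis by linarith
qed

text \<open>Strict concavity of the logarithm, in the form that at the midpoint \<open>r\<close> of two maximizers
  each factor satisfies \<open>r(I)\<^sup>2 - p(I) q(I) = (p(I) - q(I))\<^sup>2 / 4\<close>.\<close>
lemma maximizers_edge_unique:
  assumes p: "p \<in> maximizers E" and q: "q \<in> maximizers E" and I: "I \<in> E"
  shows "(\<Sum>i\<in>I. p $ i) = (\<Sum>i\<in>I. q $ i)"
proof (rule ccontr)
  assume ne: "(\<Sum>i\<in>I. p $ i) \<noteq> (\<Sum>i\<in>I. q $ i)"
  define P where "P x I = (\<Sum>i\<in>I. x $ i)" for x :: "real ^ 'v" and I
  define r where "r = (1/2) *\<^sub>R p + (1/2) *\<^sub>R q"
  have simp: "p \<in> std_simplex" "q \<in> std_simplex"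
    using p q by (auto simp: maximizers_def)
  have rS: "r \<in> std_simplex"
    unfolding r_def by (intro convexD[OF convex_std_simplex] simp) auto
  have Pr: "P r K = (P p K + P q K) / 2" for K
    by (simp add: P_def r_def sum.distrib sum_distrib_left[symmetric] sum_divide_distrib[symmetric]
        add_divide_distrib)
  have diff: "P r K ^ 2 = P p K * P q K + (P p K - P q K)^2 / 4" for K
    unfolding Pr by (simp add: field_simps power2_eq_square)
  have pos: "0 < P p K" "0 < P q K" if "K \<in> E" for K
    using maximizers_edge_pos that p q by (auto simp: P_def)
  have "(\<Prod>K\<in>E. P p K * P q K) < (\<Prod>K\<in>E. P r K ^ 2)"
  proof (rule prod_mono_strict[of I])
    show "P p I * P q I < P r I ^ 2"
      using ne unfolding diff by (simp add: P_def)
  next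
    show "0 < P r K ^ 2" if "K \<in> E" for K
      using pos[OF that] by (simp add: Pr)
  qed (use I pos diff in \<open>auto intro: less_imp_le\<close>)
  \<comment> \<open>The smaller product above is the square of the maximum; the larger one is the
    square of \<open>edge_prod E r\<close>, which cannot exceed it.\<close>
  moreover have "edge_prod E r \<le> edge_prod E p" "edge_prod E p = edge_prod E q"
    using p q rS by (auto simp: maximizers_def intro: antisym)
  moreover have "0 \<le> edge_prod E r"
    unfolding edge_prod_def by (intro prod_nonneg ballI sum_nonneg std_simplex_nonneg rS)
  ultimately show False
    using mult_mono[of "edge_prod E r" "edge_prod E p" "edge_prod E r" "edge_prod E p"]
    by (simp add: edge_prod_def P_def prod.distrib power2_eq_square)
qed

text \<open>Equal edge sums give equal products, and maximizers share their edge sums. Closedness,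
  convexity and containment in an affine subspace are all read off from this description.\<close>

lemma maximizers_eq:
  assumes "p \<in> maximizers E"
  shows "maximizers E = std_simplex \<inter> (\<Inter>I\<in>E. {x. (\<Sum>i\<in>I. x $ i) = (\<Sum>i\<in>I. p $ i)})"
    (is "_ = std_simplex \<inter> ?A")
proof
  show "maximizers E \<subseteq> std_simplex \<inter> ?A"
    using maximizers_edge_unique[OF _ assms] by (auto simp: maximizers_def)
  show "std_simplex \<inter> ?A \<subseteq> maximizers E"
  proof
    fix x assume x: "x \<in> std_simplex \<inter> ?A"
    then have "edge_prod E x = edge_prod E p"
      unfolding edge_prod_def by (intro prod.cong) auto
    with x assms show "x \<in> maximizers E"
      by (auto simp: maximizers_def)
  qed
qed

lemma affine_edge_constraints:
  "affine (\<Inter>I\<in>E. {x :: real ^ 'v. (\<Sum>i\<in>I. x $ i) = c I})"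
  unfolding affine_def
  by (auto simp: sum.distrib sum_distrib_left[symmetric] distrib_right[symmetric])

lemma closed_maximizers: "closed (maximizers E)"
proof -
  obtain p where "p \<in> maximizers E" using maximizers_nonempty by blast
  from maximizers_eq[OF this] show ?thesis
    by (auto intro!: closed_Int closed_std_simplex closed_INT closed_Collect_eq continuous_intros)
qed

lemma connected_maximizers: "connected (maximizers E)"
proof -
  obtain p where "p \<in> maximizers E" using maximizers_nonempty by blast
  from maximizers_eq[OF this] show ?thesis
    by (simp add: convex_connected convex_Int convex_std_simplex affine_imp_convex
        affine_edge_constraints)
qed

end

section \<open>Two logarithmic inequalities\<close>

text \<open>Apply \<open>ln t \<le> t - 1\<close> to each ratio of edge sums. This turns the drift
  of the weighted logarithms into a gap between values of \<open>edge_prod\<close>.\<close>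

lemma ln_edge_prod_le:
  fixes E :: "'v::finite set set"
  assumes "\<And>I. I \<in> E \<Longrightarrow> 0 < (\<Sum>i\<in>I. p $ i)" "\<And>I. I \<in> E \<Longrightarrow> 0 < (\<Sum>i\<in>I. x $ i)"
  shows "ln (edge_prod E p) - ln (edge_prod E x)
    \<le> (\<Sum>I\<in>E. (\<Sum>i\<in>I. p $ i) / (\<Sum>i\<in>I. x $ i)) - real (card E)"
proof -
  have "ln (edge_prod E p) - ln (edge_prod E x)
      = (\<Sum>I\<in>E. ln ((\<Sum>i\<in>I. p $ i) / (\<Sum>i\<in>I. x $ i)))"
    unfolding edge_prod_def using assms
    by (simp add: ln_prod ln_div sum_subtractf less_imp_neq[symmetric])
  also have "\<dots> \<le> (\<Sum>I\<in>E. (\<Sum>i\<in>I. p $ i) / (\<Sum>i\<in>I. x $ i) - 1)"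
    using assms by (intro sum_mono ln_le_minus_one) auto
  finally show ?thesis by (simp add: sum_subtractf)
qed

text \<open>Relative entropy controls distance: use
  \<open>ln t = 2 * ln (sqrt t) \<le> 2 * (sqrt t - 1)\<close> with
  \<open>t = x $ i / q $ i\<close>. The terms \<open>x $ i - q $ i\<close> of the coordinatewise
  bound cancel in the sum, and for \<open>q $ i = 0\<close> both of its sides equal
  \<open>x $ i\<close>.\<close>

lemma hellinger_le_divergence:
  fixes q x :: "real ^ 'v::finite"
  assumes "q \<in> std_simplex" "x \<in> std_simplex" "\<And>i. 0 < x $ i"
  shows "(\<Sum>i\<in>UNIV. (sqrt (x $ i) - sqrt (q $ i))\<^sup>2)
    \<le> (\<Sum>i\<in>UNIV. q $ i * ln (q $ i)) - (\<Sum>i\<in>UNIV. q $ i * ln (x $ i))"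
proof -
  have "(sqrt (x $ i) - sqrt (q $ i))\<^sup>2 \<le> x $ i - q $ i + (q $ i * ln (q $ i) - q $ i * ln (x $ i))"
    for i
  proof (cases "q $ i = 0")
    case True
    with assms(3)[of i] show ?thesis by simp
  next
    case False
    with std_simplex_nonneg[OF assms(1), of i] have q: "0 < q $ i" by simp
    have x: "0 < x $ i" by fact
    have "ln (x $ i / q $ i) = 2 * ln (sqrt (x $ i / q $ i))"
      using q x by (simp add: ln_sqrt)
    also have "\<dots> \<le> 2 * (sqrt (x $ i / q $ i) - 1)"
      using q x by (intro mult_left_mono ln_le_minus_one) auto
    finally have "q $ i * (ln (x $ i) - ln (q $ i)) \<le> q $ i * (2 * (sqrt (x $ i / q $ i) - 1))"
      using q x by (intro mult_left_mono) (auto simp: ln_div)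
    also have "\<dots> = 2 * (sqrt (x $ i) * sqrt (q $ i)) - 2 * q $ i"
      using q x by (simp add: real_sqrt_divide field_simps)
    finally show ?thesis
      using q x by (simp add: power2_diff algebra_simps)
  qed
  then have "(\<Sum>i\<in>UNIV. (sqrt (x $ i) - sqrt (q $ i))\<^sup>2)
      \<le> (\<Sum>i\<in>UNIV. x $ i - q $ i + (q $ i * ln (q $ i) - q $ i * ln (x $ i)))"
    by (intro sum_mono)
  then show ?thesis
    using assms(1,2) by (simp add: sum.distrib sum_subtractf std_simplex_def)
qed

section \<open>Convergence along a single path\<close>

text \<open>For successive values \<open>u\<close>, \<open>v\<close> the squared relative increment
  is at most \<open>c * (c + 1) * (1 / u - 1 / v)\<close>, which telescopes.\<close>

lemma sum_square_relative_increments_le: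
  fixes a :: "nat \<Rightarrow> real"
  assumes a0: "1 \<le> a 0" and mono: "\<And>n. a n \<le> a (Suc n)" and step: "\<And>n. a (Suc n) \<le> a n + c"
  shows "(\<Sum>k<n. ((a (Suc k) - a k) / a k)\<^sup>2) \<le> c * (c + 1)"
proof -
  have a1: "1 \<le> a n" for n
    using a0 lift_Suc_mono_le[of a 0 n] mono by force
  have c: "0 \<le> c" using mono[of 0] step[of 0] by linarith
  have "(\<Sum>k<n. ((a (Suc k) - a k) / a k)\<^sup>2) \<le> c * (c + 1) * (1 - 1 / a n)"
  proof (induction n)
    case 0
    then show ?case using a1[of 0] c by simp
  next
    case (Suc n)
    define u v where "u = a n" and "v = a (Suc n)"
    have uv: "1 \<le> u" "u \<le> v" "v \<le> u + c"
      using a1 mono step by (auto simp: u_def v_def)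
    \<comment> \<open>Here \<open>v - u \<le> c\<close>, and
      \<open>v \<le> u + c \<le> u * (c + 1)\<close> because \<open>1 \<le> u\<close>; this is the
      origin of the constant.\<close>
    have "v * (v - u) \<le> (u * (c + 1)) * c"
      using uv c mult_right_mono[of 1 u c] by (intro mult_mono) (auto simp: algebra_simps)
    from mult_right_mono[OF this, of "v - u"]
    have "(v - u)\<^sup>2 * v \<le> c * (c + 1) * (v - u) * u" 
      using uv by (simp add: power2_eq_square algebra_simps)
    then have "(v - u)\<^sup>2 * v / (u\<^sup>2 * v) \<le> c * (c + 1) * (v - u) * u / (u\<^sup>2 * v)"
      using uv by (intro divide_right_mono) auto
    then have "((v - u) / u)\<^sup>2 \<le> c * (c + 1) * ((v - u) / (u * v))"
      using uv by (simp add: power_divide power2_eq_square)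
    also have "(v - u) / (u * v) = 1 / u - 1 / v"
      using uv by (simp add: diff_divide_distrib)
    finally have "((v - u) / u)\<^sup>2 \<le> c * (c + 1) * (1 / u - 1 / v)" .
    then show ?case using Suc by (simp add: u_def v_def algebra_simps)
  qed
  also have "\<dots> \<le> c * (c + 1) * 1"
    using a1[of n] c by (intro mult_left_mono) auto
  finally show ?thesis by simp
qed

text \<open>A vertex can more than double in one step, so the quadratic lower bound is wanted beyond
  \<open>x = 1\<close>, where its left side is negative.\<close>

lemma ln_add_one_ge:
  fixes x :: real assumes "0 \<le> x" shows "x - x\<^sup>2 \<le> ln (1 + x)"
proof (cases "x \<le> 1")
  case True then show ?thesis using ln_one_plus_pos_lower_bound[of x] assms by simp
next
  case False
  then have "x - x\<^sup>2 \<le> 0" by (simp add: power2_eq_square)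
  then show ?thesis using assms ln_ge_zero[of "1 + x"] by linarith
qed


text \<open>The deterministic half of the proof. Randomness enters only through
  \<open>noise\<close>, one condition for each of the finitely many vertices; linear combinations of
  these conditions serve all maximizers at once.\<close>

lemma urn_path_converges:
  fixes E :: "'v::finite set set" and b :: "nat \<Rightarrow> 'v \<Rightarrow> nat"
  assumes nonempty: "\<forall>I\<in>E. I \<noteq> {}" and cover: "\<Union>E = UNIV"
    and b0: "\<And>i. 1 \<le> b 0 i"
    and mono: "\<And>n i. b n i \<le> b (Suc n) i" and step: "\<And>n i. b (Suc n) i \<le> b n i + card E"
    and total: "\<And>n. sum (b n) UNIV = sum (b 0) UNIV + n * card E"
    and noise: "\<And>i. convergent (\<lambda>n. \<Sum>k<n. (real (b (Suc k) i) - real (b k i)) / real (b k i)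
                        - (\<Sum>I | I \<in> E \<and> i \<in> I. 1 / real (sum (b k) I)))"
  shows "\<exists>p\<in>maximizers E.
    (\<lambda>n. \<chi> i. real (b n i) / (real (sum (b 0) UNIV) + real n * real (card E))) \<longlonglongrightarrow> p"
proof -
  define N where "N = real (card E)"
  define T where "T n = real (sum (b 0) UNIV) + real n * N" for n
  define x :: "nat \<Rightarrow> real ^ 'v" where "x n = (\<chi> i. real (b n i) / T n)" for n
  \<comment> \<open>\<open>D\<close> is the relative increment minus its conditional mean,
    \<open>R\<close> the quadratic error in the lower bound for the logarithm.\<close>
  define D where "D i k = (real (b (Suc k) i) - real (b k i)) / real (b k i)
                        - (\<Sum>I | I \<in> E \<and> i \<in> I. 1 / real (sum (b k) I))" for i k
  define R where "R i k = ((real (b (Suc k) i) - real (b k i)) / real (b k i))\<^sup>2" for i k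
  have b1: "1 \<le> b n i" for n i
    by (induction n) (use b0 mono order_trans in blast)+
  then have bpos: "0 < real (b n i)" for n i
    by (metis less_le_trans of_nat_0_less_iff zero_less_one)
  have T_total: "T n = (\<Sum>i\<in>UNIV. real (b n i))" for n
    unfolding T_def N_def using arg_cong[OF total[of n], of real] by simp
  have Tpos: "0 < T n" for n
    unfolding T_total using bpos by (intro sum_pos) auto
  have xpos: "0 < x n $ i" for n i
    using bpos Tpos by (simp add: x_def)
  have xS: "x n \<in> std_simplex" for n
    using Tpos[of n] xpos[of n]
    by (auto simp: std_simplex_def less_imp_le x_def sum_divide_distrib[symmetric] T_total[symmetric])
  have x_edge: "(\<Sum>i\<in>I. x n $ i) = real (sum (b n) I) / T n" for n I
    by (simp add: x_def sum_divide_distrib)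
  have x_edge_pos: "0 < (\<Sum>i\<in>I. x n $ i)" if "I \<in> E" for n I
    using that nonempty xpos by (intro sum_pos) auto
  have "convergent (\<lambda>n. \<Sum>k<n. R i k)" for i
  proof -
    have "(\<Sum>k<n. R i k) \<le> N * (N + 1)" for n
      unfolding R_def N_def
    proof (rule sum_square_relative_increments_le)
      show "real (b (Suc k) i) \<le> real (b k i) + real (card E)" for k
        using step[of k i] by linarith
    qed (use b1 mono in auto)
    then have "summable (R i)"
      by (intro summableI_nonneg_bounded) (auto simp: R_def)
    then show ?thesis by (simp add: summable_iff_convergent)
  qed
  then have DR: "convergent (\<lambda>n. (\<Sum>k<n. D i k) - (\<Sum>k<n. R i k))" for i
    using noise by (intro convergent_diff) (auto simp: D_def)
  define w where "w p n = (\<Sum>i\<in>UNIV. p $ i * ln (x n $ i))" for p :: "real ^ 'v" and n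
  \<comment> \<open>\<open>K p n\<close> is the first-order drift of \<open>w p\<close>, nonnegative
    at every maximizer \<open>p\<close>.\<close>
  define K where "K p n = (1 / T n) * ((\<Sum>I\<in>E. (\<Sum>i\<in>I. p $ i) / (\<Sum>i\<in>I. x n $ i)) - N)" for p n
  have K_ge: "(1 / T n) * (ln (edge_prod E p) - ln (edge_prod E (x n))) \<le> K p n"
    if "p \<in> maximizers E" for p n
    unfolding K_def N_def using Tpos[of n] maximizers_edge_pos[OF nonempty that] x_edge_pos
    by (intro mult_left_mono ln_edge_prod_le) auto
  have edge_prod_pos: "0 < edge_prod E (x n)" for n
    unfolding edge_prod_def using x_edge_pos by (intro prod_pos) auto
  have max_pos: "0 < edge_prod E p" if "p \<in> maximizers E" for p
    unfolding edge_prod_def using maximizers_edge_pos[OF nonempty that] by (intro prod_pos) auto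
  have K_nonneg: "0 \<le> K p n" if "p \<in> maximizers E" for p n
  proof -
    have "edge_prod E (x n) \<le> edge_prod E p"
      using that xS by (auto simp: maximizers_def)
    then have "ln (edge_prod E (x n)) \<le> ln (edge_prod E p)"
      using edge_prod_pos[of n] ln_mono by blast
    then have "0 \<le> (1 / T n) * (ln (edge_prod E p) - ln (edge_prod E (x n)))"
      using Tpos[of n] by simp
    with K_ge[OF that, of n] show ?thesis by linarith
  qed
  \<comment> \<open>Since \<open>x = b / T\<close>, each \<open>ln (x k $ i)\<close> gains at least
    \<open>D - R\<close> plus the drift of vertex \<open>i\<close>, minus at most
    \<open>N / T k\<close>. Weighting by \<open>p\<close> and exchanging vertices with edges
    collects the drifts into the edge sums of \<open>p\<close>.\<close>
  have w_step: "K p k \<le> w p (Suc k) - w p k - (\<Sum>i\<in>UNIV. p $ i * (D i k - R i k))"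
    if p: "p \<in> maximizers E" for p k
  proof -
    have pS: "p \<in> std_simplex" using p by (simp add: maximizers_def)
    have ln_T: "ln (T (Suc k)) - ln (T k) \<le> N / T k"
    proof -
      have "ln (T (Suc k)) - ln (T k) = ln (T (Suc k) / T k)"
        using Tpos by (simp add: ln_div less_imp_neq[symmetric])
      also have "\<dots> \<le> T (Suc k) / T k - 1"
        using Tpos by (intro ln_le_minus_one) auto
      also have "\<dots> = N / T k"
        using Tpos[of k] by (simp add: field_simps T_def)
      finally show ?thesis .
    qed
    have "D i k - R i k + (\<Sum>I | I \<in> E \<and> i \<in> I. 1 / real (sum (b k) I)) - N / T k
        \<le> ln (x (Suc k) $ i) - ln (x k $ i)" for i
    proof -
      have "D i k - R i k + (\<Sum>I | I \<in> E \<and> i \<in> I. 1 / real (sum (b k) I))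
          \<le> ln (1 + (real (b (Suc k) i) - real (b k i)) / real (b k i))"
        unfolding D_def R_def using mono[of k i]
        using ln_add_one_ge[of "(real (b (Suc k) i) - real (b k i)) / real (b k i)"] by simp
      also have "\<dots> = ln (b (Suc k) i) - ln (b k i)"
        using bpos[of k i] bpos[of "Suc k" i] by (simp add: diff_divide_distrib ln_div)
      also have "\<dots> = ln (x (Suc k) $ i) - ln (x k $ i) + (ln (T (Suc k)) - ln (T k))"
        using bpos[of k i] bpos[of "Suc k" i] Tpos[of k] Tpos[of "Suc k"] by (simp add: x_def ln_div)
      finally show ?thesis using ln_T by linarith
    qed
    then have "(\<Sum>i\<in>UNIV. p $ i * (D i k - R i k + (\<Sum>I | I \<in> E \<and> i \<in> I. 1 / real (sum (b k) I)) - N / T k))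
        \<le> (\<Sum>i\<in>UNIV. p $ i * (ln (x (Suc k) $ i) - ln (x k $ i)))"
      by (intro sum_mono mult_left_mono std_simplex_nonneg pS)
    also have "\<dots> = w p (Suc k) - w p k"
      by (simp add: w_def sum_subtractf right_diff_distrib)
    also have "(\<Sum>i\<in>UNIV. p $ i * (D i k - R i k + (\<Sum>I | I \<in> E \<and> i \<in> I. 1 / real (sum (b k) I)) - N / T k))
        = (\<Sum>i\<in>UNIV. p $ i * (D i k - R i k))
          + ((\<Sum>i\<in>UNIV. p $ i * (\<Sum>I | I \<in> E \<and> i \<in> I. 1 / real (sum (b k) I))) - (\<Sum>i\<in>UNIV. p $ i) * (N / T k))"
      unfolding sum_distrib_right sum_subtractf[symmetric] sum.distrib[symmetric]
      by (simp add: algebra_simps)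
    also have "(\<Sum>i\<in>UNIV. p $ i * (\<Sum>I | I \<in> E \<and> i \<in> I. 1 / real (sum (b k) I)))
        = (\<Sum>i\<in>UNIV. \<Sum>I | I \<in> E \<and> i \<in> I. p $ i / real (sum (b k) I))"
      by (simp add: sum_distrib_left)
    also have "\<dots> = (\<Sum>I\<in>E. \<Sum>i | i \<in> UNIV \<and> i \<in> I. p $ i / real (sum (b k) I))"
      by (rule sum.swap_restrict) auto
    also have "\<dots> = (\<Sum>I\<in>E. (\<Sum>i\<in>I. p $ i) / real (sum (b k) I))"
      by (simp add: sum_divide_distrib)
    also have "\<dots> = (1 / T k) * (\<Sum>I\<in>E. (\<Sum>i\<in>I. p $ i) / (\<Sum>i\<in>I. x k $ i))"
      unfolding x_edge using Tpos[of k] by (simp add: sum_distrib_left)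
    also have "(\<Sum>i\<in>UNIV. p $ i) * (N / T k) = (1 / T k) * N"
      using pS by (simp add: std_simplex_def)
    finally show ?thesis
      by (simp add: K_def right_diff_distrib)
  qed
  have w_conv: "convergent (w p)" and K_summable: "summable (K p)" if p: "p \<in> maximizers E" for p
  proof -
    have pS: "p \<in> std_simplex" using p by (simp add: maximizers_def)
    \<comment> \<open>\<open>C\<close> is the increment of \<open>w p\<close> without the convergent
      error \<open>S\<close>. It is nonnegative and, as \<open>w p \<le> 0\<close>, has bounded
      partial sums.\<close>
    define C where "C k = w p (Suc k) - w p k - (\<Sum>i\<in>UNIV. p $ i * (D i k - R i k))" for k
    define S where "S n = (\<Sum>i\<in>UNIV. p $ i * ((\<Sum>k<n. D i k) - (\<Sum>k<n. R i k)))" for n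
    have C_ge: "K p k \<le> C k" for k unfolding C_def by (rule w_step[OF p])
    have S_sum: "S n = (\<Sum>k<n. \<Sum>i\<in>UNIV. p $ i * (D i k - R i k))" for n
      unfolding S_def by (subst sum.swap) (simp add: sum_distrib_left sum_subtractf right_diff_distrib)
    have C_sum: "(\<Sum>k<n. C k) = w p n - w p 0 - S n" for n
      unfolding C_def S_sum sum_subtractf by (simp only: sum_lessThan_telescope[symmetric] sum_subtractf)
    have S_conv: "convergent S"
      unfolding S_def by (intro convergent_sum convergent_mult convergent_const DR)
    then obtain B where B: "\<And>n. norm (S n) \<le> B"
      using convergent_imp_Bseq BseqE by metis
    have "w p n \<le> 0" for n
      unfolding w_def using std_simplex_nonneg[OF pS] std_simplex_le_1[OF xS] xpos
      by (intro sum_nonpos mult_nonneg_nonpos) auto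
    then have "(\<Sum>k<n. C k) \<le> B - w p 0" for n
      unfolding C_sum using B[of n] by (smt (verit) real_norm_def)
    then have C_summable: "summable C"
      using C_ge K_nonneg[OF p] order_trans by (intro summableI_nonneg_bounded) blast+
    have "convergent (\<lambda>n. w p 0 + (\<Sum>k<n. C k) + S n)"
      using C_summable S_conv
      by (intro convergent_add convergent_const) (auto simp: summable_iff_convergent)
    then show "convergent (w p)" unfolding C_sum by simp
    show "summable (K p)"
      by (rule summable_comparison_test'[OF C_summable, of 0]) (use C_ge K_nonneg[OF p] in auto)
  qed
  obtain p where p: "p \<in> maximizers E"
    using maximizers_nonempty[OF nonempty] by blast
  \<comment> \<open>Otherwise \<open>K p\<close> would exceed a multiple of \<open>1 / T\<close>
    from \<open>j\<close> on, against summability, since \<open>T\<close> grows linearly. The index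
    \<open>j\<close> is both starting time and precision.\<close>
  have frequent: "\<exists>k\<ge>j. edge_prod E p * exp (- (1 / real (Suc j))) < edge_prod E (x k)" for j
  proof (rule ccontr)
    assume "\<not> ?thesis"
    then have le: "edge_prod E (x k) \<le> edge_prod E p * exp (- (1 / real (Suc j)))" if "k \<ge> j" for k
      using that by force
    define d where "d = 1 / real (Suc j)"
    have dpos: "0 < d" by (simp add: d_def)
    \<comment> \<open>The factor \<open>T 0 + N\<close> comes from
      \<open>T k \<le> (T 0 + N) * real (Suc k)\<close>, the factor \<open>1 / d\<close> from the
      logarithmic gap.\<close>
    have "norm (1 / real (Suc k)) \<le> (T 0 + N) / d * K p k" if "k \<ge> j" for k
    proof -
      have "ln (edge_prod E (x k)) \<le> ln (edge_prod E p * exp (- d))"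
        using le[OF that] edge_prod_pos unfolding d_def by (subst ln_le_cancel_iff) (use max_pos[OF p] in auto)
      also have "\<dots> = ln (edge_prod E p) - d"
        using max_pos[OF p] by (simp add: ln_mult)
      finally have "(1 / T k) * d \<le> (1 / T k) * (ln (edge_prod E p) - ln (edge_prod E (x k)))"
        using Tpos[of k] by (intro mult_left_mono) auto
      also have "\<dots> \<le> K p k" by (rule K_ge[OF p])
      finally have "1 / T k \<le> K p k / d"
        using dpos by (simp add: field_simps)
      then have "(T 0 + N) * (1 / T k) \<le> (T 0 + N) * (K p k / d)"
        using Tpos[of 0] by (intro mult_left_mono) (auto simp: N_def)
      moreover have "1 / real (Suc k) \<le> (T 0 + N) * (1 / T k)"
        using Tpos[of k] Tpos[of 0] by (simp add: field_simps T_def N_def)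
      ultimately show ?thesis by simp
    qed
    then have "summable (\<lambda>k. 1 / real (Suc k))"
      by (intro summable_comparison_test'[OF summable_mult[OF K_summable[OF p]]])
    then show False
      using not_summable_harmonic[where 'a = real] summable_Suc_iff[of "\<lambda>k. 1 / real k"]
      by (simp add: inverse_eq_divide)
  qed
  then obtain r where r: "\<And>j. j \<le> r j"
    "\<And>j. edge_prod E p * exp (- (1 / real (Suc j))) < edge_prod E (x (r j))"
    by metis
  obtain q s where q: "q \<in> std_simplex" and s: "strict_mono s" and lim: "((x \<circ> r) \<circ> s) \<longlonglongrightarrow> q"
    using compact_std_simplex xS unfolding compact_def by (metis comp_apply)
  \<comment> \<open>The indices \<open>r\<close> may fail to increase; \<open>j \<le> r j\<close>
    suffices for them to tend to infinity.\<close>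
  have rs: "filterlim (r \<circ> s) sequentially sequentially"
  proof (rule filterlim_at_top_mono[OF filterlim_ident])
    show "\<forall>\<^sub>F n in sequentially. n \<le> (r \<circ> s) n"
      using order_trans[OF seq_suble[OF s] r(1)] by (auto intro!: always_eventually)
  qed
  have q_max: "q \<in> maximizers E"
  proof -
    have upper: "(\<lambda>j. edge_prod E ((x \<circ> r \<circ> s) j)) \<longlonglongrightarrow> edge_prod E q"
      by (rule continuous_on_tendsto_compose[OF continuous_on_edge_prod[of UNIV E] lim]) auto
    have lower: "(\<lambda>j. edge_prod E p * exp (- (1 / real (Suc (s j))))) \<longlonglongrightarrow> edge_prod E p * exp (- 0)"
      using LIMSEQ_subseq_LIMSEQ[OF LIMSEQ_inverse_real_of_nat s]
      by (intro tendsto_intros) (simp add: o_def inverse_eq_divide)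
    have "edge_prod E p * exp (- 0) \<le> edge_prod E q"
      by (rule LIMSEQ_le[OF lower upper]) (use r(2) in \<open>auto intro: less_imp_le\<close>)
    with p q show ?thesis
      unfolding maximizers_def by (auto intro: order_trans)
  qed
  have "(\<lambda>j. w q ((r \<circ> s) j)) \<longlonglongrightarrow> (\<Sum>i\<in>UNIV. q $ i * ln (q $ i))"
    unfolding w_def
  proof (rule tendsto_sum)
    fix i
    show "(\<lambda>j. q $ i * ln (x ((r \<circ> s) j) $ i)) \<longlonglongrightarrow> q $ i * ln (q $ i)"
    \<comment> \<open>A vanishing coordinate of \<open>q\<close> removes its term altogether, so
      \<open>ln (x n $ i)\<close> may diverge there.\<close>
    proof (cases "q $ i = 0")
      case False
      have "(\<lambda>j. x ((r \<circ> s) j) $ i) \<longlonglongrightarrow> q $ i"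
        using tendsto_vec_nth[OF lim, of i] by (simp add: o_def)
      from tendsto_mult[OF tendsto_const tendsto_ln[OF this False]] show ?thesis .
    qed simp
  qed
  \<comment> \<open>As \<open>w q\<close> converges along the full sequence, its limit is the one
    found along the subsequence.\<close>
  moreover obtain l where l: "w q \<longlonglongrightarrow> l"
    using w_conv[OF q_max] by (auto simp: convergent_def)
  moreover have "(\<lambda>j. w q ((r \<circ> s) j)) \<longlonglongrightarrow> l"
    using filterlim_compose[OF l rs] by simp
  ultimately have w_lim: "w q \<longlonglongrightarrow> (\<Sum>i\<in>UNIV. q $ i * ln (q $ i))"
    using LIMSEQ_unique by metis
  have "x \<longlonglongrightarrow> q"
  proof (rule vec_tendstoI)
    fix i
    \<comment> \<open>The gap is the relative entropy of \<open>q\<close> with respect to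
      \<open>x n\<close>.\<close>
    have gap: "(\<lambda>n. (\<Sum>i\<in>UNIV. q $ i * ln (q $ i)) - w q n) \<longlonglongrightarrow> 0"
      using tendsto_diff[OF tendsto_const w_lim, of "\<Sum>i\<in>UNIV. q $ i * ln (q $ i)"] by simp
    have "\<forall>n. norm ((sqrt (x n $ i) - sqrt (q $ i))\<^sup>2) \<le> (\<Sum>i\<in>UNIV. q $ i * ln (q $ i)) - w q n"
    proof
      fix n
      have "norm ((sqrt (x n $ i) - sqrt (q $ i))\<^sup>2) \<le> (\<Sum>i\<in>UNIV. (sqrt (x n $ i) - sqrt (q $ i))\<^sup>2)"
        using member_le_sum[of i UNIV "\<lambda>i. (sqrt (x n $ i) - sqrt (q $ i))\<^sup>2"] by simp
      then show "norm ((sqrt (x n $ i) - sqrt (q $ i))\<^sup>2) \<le> (\<Sum>i\<in>UNIV. q $ i * ln (q $ i)) - w q n"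
        using hellinger_le_divergence[OF q xS xpos, of n] unfolding w_def by linarith
    qed
    from Lim_null_comparison[OF always_eventually[OF this] gap]
    have "(\<lambda>n. (sqrt (x n $ i) - sqrt (q $ i))\<^sup>2) \<longlonglongrightarrow> 0" .
    from tendsto_real_sqrt[OF this] have "(\<lambda>n. \<bar>sqrt (x n $ i) - sqrt (q $ i)\<bar>) \<longlonglongrightarrow> 0"
      by simp
    then have "(\<lambda>n. sqrt (x n $ i) - sqrt (q $ i)) \<longlonglongrightarrow> 0"
      by (rule tendsto_rabs_zero_cancel)
    then have "(\<lambda>n. sqrt (x n $ i)) \<longlonglongrightarrow> sqrt (q $ i)"
      by (simp add: LIM_zero_iff)
    from tendsto_power[OF this, of 2] show "(\<lambda>n. x n $ i) \<longlonglongrightarrow> q $ i"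
      using xpos std_simplex_nonneg[OF q] by (simp add: less_imp_le)
  qed
  moreover have "x = (\<lambda>n. \<chi> i. real (b n i) / (real (sum (b 0) UNIV) + real n * real (card E)))"
    by (simp add: fun_eq_iff x_def T_def N_def)
  ultimately show ?thesis
    using q_max by (intro bexI[of _ q]) simp_all
qed

section \<open>Convergence of square-summable martingales\<close>

text \<open>Integrability of all functions of the history is a strong requirement; it holds when each
  \<open>H n\<close> almost surely takes only finitely many values.\<close>
locale history_martingale = prob_space M for M :: "'w measure" +
  fixes H :: "nat \<Rightarrow> 'w \<Rightarrow> 'h" and D :: "nat \<Rightarrow> 'w \<Rightarrow> real"
  assumes adapted: "\<And>n. \<exists>d. \<forall>\<omega>. D n \<omega> = d (H (Suc n) \<omega>)"
    and history: "\<And>n. \<exists>\<pi>. \<forall>\<omega>. H n \<omega> = \<pi> (H (Suc n) \<omega>)"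
    and integrable_history: "\<And>n (g :: 'h \<Rightarrow> real). integrable M (\<lambda>\<omega>. g (H n \<omega>))"
    and orthogonal: "\<And>n g. expectation (\<lambda>\<omega>. g (H n \<omega>) * D n \<omega>) = 0"
begin

text \<open>The sum of the increments from \<open>m\<close> on, frozen once it reaches
  \<open>\<epsilon>\<close> in absolute value. The decision precedes the increment
  \<open>D (m + j)\<close>, hence is a function of \<open>H (m + j)\<close> and orthogonality
  applies.\<close>

primrec stopped :: "real \<Rightarrow> nat \<Rightarrow> nat \<Rightarrow> 'w \<Rightarrow> real" where
  "stopped \<epsilon> m 0 \<omega> = 0"
| "stopped \<epsilon> m (Suc j) \<omega> =
     stopped \<epsilon> m j \<omega> + (if \<epsilon> \<le> \<bar>stopped \<epsilon> m j \<omega>\<bar> then 0 else D (m + j) \<omega>)"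

lemma stopped_adapted: "\<exists>g. \<forall>\<omega>. stopped \<epsilon> m j \<omega> = g (H (m + j) \<omega>)"
proof (induction j)
  case 0
  show ?case by (auto intro: exI[of _ "\<lambda>_. 0"])
next
  case (Suc j)
  then obtain g where g: "\<And>\<omega>. stopped \<epsilon> m j \<omega> = g (H (m + j) \<omega>)" by blast
  obtain d \<pi> where "\<And>\<omega>. D (m + j) \<omega> = d (H (Suc (m + j)) \<omega>)"
    "\<And>\<omega>. H (m + j) \<omega> = \<pi> (H (Suc (m + j)) \<omega>)"
    using adapted history by metis
  then show ?case
    by (intro exI[of _ "\<lambda>h. g (\<pi> h) + (if \<epsilon> \<le> \<bar>g (\<pi> h)\<bar> then 0 else d h)"]) (simp add: g)
qed

lemma integrable_increment_sq: "integrable M (\<lambda>\<omega>. (D n \<omega>)\<^sup>2)"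
  using adapted[of n] integrable_history[of "\<lambda>h. (_ h)\<^sup>2" "Suc n"] by auto

lemma measurable_D [measurable]: "D n \<in> borel_measurable M"
proof -
  obtain d where d: "\<And>\<omega>. D n \<omega> = d (H (Suc n) \<omega>)" using adapted by metis
  show ?thesis
    using borel_measurable_integrable[OF integrable_history[of d "Suc n"]]
    by (simp add: d[symmetric])
qed

text \<open>Expanding the square, the cross term has mean 0 by orthogonality, and freezing only
  drops nonnegative squares.\<close>

lemma second_moment_stopped:
  "integrable M (\<lambda>\<omega>. (stopped \<epsilon> m j \<omega>)\<^sup>2) \<and>
   expectation (\<lambda>\<omega>. (stopped \<epsilon> m j \<omega>)\<^sup>2) \<le> (\<Sum>k<j. expectation (\<lambda>\<omega>. (D (m + k) \<omega>)\<^sup>2))"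
proof (induction j)
  case 0
  show ?case by simp
next
  case (Suc j)
  obtain g where g: "\<And>\<omega>. stopped \<epsilon> m j \<omega> = g (H (m + j) \<omega>)" using stopped_adapted by metis
  obtain d \<pi> where d: "\<And>\<omega>. D (m + j) \<omega> = d (H (Suc (m + j)) \<omega>)"
    and \<pi>: "\<And>\<omega>. H (m + j) \<omega> = \<pi> (H (Suc (m + j)) \<omega>)"
    using adapted history by metis
  define c where "c h = (if \<epsilon> \<le> \<bar>g h\<bar> then 0 else 1 :: real)" for h
  have eq: "(stopped \<epsilon> m (Suc j) \<omega>)\<^sup>2 = (stopped \<epsilon> m j \<omega>)\<^sup>2
      + 2 * ((g (H (m + j) \<omega>) * c (H (m + j) \<omega>)) * D (m + j) \<omega>)
      + c (H (m + j) \<omega>) * (D (m + j) \<omega>)\<^sup>2" for \<omega>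
    by (simp add: g c_def power2_eq_square algebra_simps)
  have int2: "integrable M (\<lambda>\<omega>. (g (H (m + j) \<omega>) * c (H (m + j) \<omega>)) * D (m + j) \<omega>)"
    unfolding d \<pi> by (rule integrable_history[of "\<lambda>h. g (\<pi> h) * c (\<pi> h) * d h"])
  have int3: "integrable M (\<lambda>\<omega>. c (H (m + j) \<omega>) * (D (m + j) \<omega>)\<^sup>2)"
    unfolding d \<pi> by (rule integrable_history[of "\<lambda>h. c (\<pi> h) * (d h)\<^sup>2"])
  have "expectation (\<lambda>\<omega>. c (H (m + j) \<omega>) * (D (m + j) \<omega>)\<^sup>2) \<le> expectation (\<lambda>\<omega>. (D (m + j) \<omega>)\<^sup>2)"
    by (intro integral_mono int3 integrable_increment_sq) (simp add: c_def)
  moreover have "expectation (\<lambda>\<omega>. (g (H (m + j) \<omega>) * c (H (m + j) \<omega>)) * D (m + j) \<omega>) = 0"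
    using orthogonal[of "\<lambda>h. g h * c h"] by simp
  ultimately show ?case
    unfolding eq using Suc.IH int2 int3 by simp
qed

text \<open>Kolmogorov's inequality: once the partial sums have left \<open>(-\<epsilon>, \<epsilon>)\<close> the stopped sum stays outside,
  so Chebyshev's inequality for its final value suffices.\<close>
lemma maximal_inequality:
  assumes "0 < \<epsilon>"
  shows "prob {\<omega>\<in>space M. \<exists>j\<le>J. \<epsilon> \<le> \<bar>\<Sum>k<j. D (m + k) \<omega>\<bar>}
    \<le> (\<Sum>k<J. expectation (\<lambda>\<omega>. (D (m + k) \<omega>)\<^sup>2)) / \<epsilon>\<^sup>2"
proof -
  have not_left: "stopped \<epsilon> m j \<omega> = (\<Sum>k<j. D (m + k) \<omega>) \<or> \<epsilon> \<le> \<bar>stopped \<epsilon> m j \<omega>\<bar>" for j \<omega>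
    by (induction j) auto
  have left: "\<epsilon> \<le> \<bar>stopped \<epsilon> m i \<omega>\<bar>" if "j \<le> i" "\<epsilon> \<le> \<bar>stopped \<epsilon> m j \<omega>\<bar>" for i j \<omega>
    using that by (induction i rule: dec_induct) auto
  have int: "integrable M (\<lambda>\<omega>. (stopped \<epsilon> m J \<omega>)\<^sup>2)"
    using second_moment_stopped by blast
  have "\<epsilon>\<^sup>2 \<le> (stopped \<epsilon> m J \<omega>)\<^sup>2" if "j \<le> J" "\<epsilon> \<le> \<bar>\<Sum>k<j. D (m + k) \<omega>\<bar>" for j \<omega>
  proof -
    have "\<epsilon> \<le> \<bar>stopped \<epsilon> m j \<omega>\<bar>"
      using that(2) not_left[of j \<omega>] by auto
    from left[OF that(1) this] show ?thesis
      using assms abs_le_square_iff[of \<epsilon> "stopped \<epsilon> m J \<omega>"] by simp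
  qed
  then have "prob {\<omega>\<in>space M. \<exists>j\<le>J. \<epsilon> \<le> \<bar>\<Sum>k<j. D (m + k) \<omega>\<bar>}
      \<le> prob {\<omega>\<in>space M. \<epsilon>\<^sup>2 \<le> (stopped \<epsilon> m J \<omega>)\<^sup>2}"
    using borel_measurable_integrable[OF int] by (intro finite_measure_mono) auto
  also have "\<dots> \<le> expectation (\<lambda>\<omega>. (stopped \<epsilon> m J \<omega>)\<^sup>2) / \<epsilon>\<^sup>2"
    using int assms by (intro integral_Markov_inequality_measure[where A = "{}"]) auto
  also have "\<dots> \<le> (\<Sum>k<J. expectation (\<lambda>\<omega>. (D (m + k) \<omega>)\<^sup>2)) / \<epsilon>\<^sup>2"
    using second_moment_stopped by (intro divide_right_mono) auto
  finally show ?thesis .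
qed

text \<open>The maximal inequality bounds the oscillation after time \<open>m\<close> by the tail of
  the variances, which tends to 0; hence the sums are almost surely Cauchy.\<close>

lemma AE_convergent_increment_sums:
  assumes var: "summable (\<lambda>n. expectation (\<lambda>\<omega>. (D n \<omega>)\<^sup>2))"
  shows "AE \<omega> in M. convergent (\<lambda>n. \<Sum>k<n. D k \<omega>)"
proof -
  define V where "V m = (\<Sum>k. expectation (\<lambda>\<omega>. (D (m + k) \<omega>)\<^sup>2))" for m
  define A where "A \<epsilon> m = {\<omega>\<in>space M. \<exists>j. \<epsilon> \<le> \<bar>\<Sum>k<j. D (m + k) \<omega>\<bar>}" for \<epsilon> :: real and m
  have A_meas [measurable]: "A \<epsilon> m \<in> events" for \<epsilon> m
    unfolding A_def by measurable
  have summable_shift: "summable (\<lambda>k. expectation (\<lambda>\<omega>. (D (m + k) \<omega>)\<^sup>2))" for m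
    using summable_ignore_initial_segment[OF var, of m] by (simp add: add.commute)
  have V_lim: "V \<longlonglongrightarrow> 0"
    unfolding V_def using suminf_exist_split2[OF var] by (simp add: add.commute)
  have A_le: "prob (A \<epsilon> m) \<le> V m / \<epsilon>\<^sup>2" if "0 < \<epsilon>" for \<epsilon> m
  proof -
    \<comment> \<open>The maximal inequality has a finite horizon \<open>J\<close>; continuity from
      below removes it.\<close>
    define A' where "A' J = {\<omega>\<in>space M. \<exists>j\<le>J. \<epsilon> \<le> \<bar>\<Sum>k<j. D (m + k) \<omega>\<bar>}" for J
    have "(\<lambda>J. prob (A' J)) \<longlonglongrightarrow> prob (\<Union>J. A' J)"
    proof (rule finite_Lim_measure_incseq)
      show "range A' \<subseteq> events" unfolding A'_def by auto
      show "incseq A'" unfolding A'_def incseq_def by (auto intro: order_trans)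
    qed
    moreover have "(\<Union>J. A' J) = A \<epsilon> m"
      by (auto simp: A'_def A_def)
    moreover have "prob (A' J) \<le> V m / \<epsilon>\<^sup>2" for J
    proof -
      have "(\<Sum>k<J. expectation (\<lambda>\<omega>. (D (m + k) \<omega>)\<^sup>2)) \<le> V m"
        unfolding V_def by (intro sum_le_suminf summable_shift) auto
      with maximal_inequality[OF that, of J m] show ?thesis
        unfolding A'_def by (meson divide_right_mono order_trans zero_le_power2)
    qed
    ultimately show ?thesis
      by (metis LIMSEQ_le_const2)
  qed
  have "AE \<omega> in M. \<exists>m. \<omega> \<notin> A (1 / real (Suc r)) m" for r
  proof -
    define \<epsilon> where "\<epsilon> = 1 / real (Suc r)"
    \<comment> \<open>Oscillation of size \<open>\<epsilon>\<close> after every \<open>m\<close> is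
      bounded by every tail, hence null.\<close>
    have "prob (\<Inter>m. A \<epsilon> m) \<le> V m / \<epsilon>\<^sup>2" for m
    proof -
      have "prob (\<Inter>m. A \<epsilon> m) \<le> prob (A \<epsilon> m)"
        by (intro finite_measure_mono) auto
      also have "\<dots> \<le> V m / \<epsilon>\<^sup>2"
        by (rule A_le) (simp add: \<epsilon>_def)
      finally show ?thesis .
    qed
    moreover have "(\<lambda>m. V m / \<epsilon>\<^sup>2) \<longlonglongrightarrow> 0 / \<epsilon>\<^sup>2"
      by (intro tendsto_intros V_lim) (simp add: \<epsilon>_def)
    ultimately have "prob (\<Inter>m. A \<epsilon> m) \<le> 0 / \<epsilon>\<^sup>2"
      by (metis LIMSEQ_le_const)
    then have "prob (\<Inter>m. A \<epsilon> m) = 0"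
      by (simp add: measure_le_0_iff)
    then have "AE \<omega> in M. \<omega> \<notin> (\<Inter>m. A \<epsilon> m)"
      by (subst (asm) prob_eq_0) auto
    then show ?thesis by (auto simp: \<epsilon>_def)
  qed
  then have "AE \<omega> in M. \<forall>r. \<exists>m. \<omega> \<notin> A (1 / real (Suc r)) m"
    by (simp add: AE_all_countable)
  with AE_space show ?thesis
  proof eventually_elim
    case (elim \<omega>)
    have split: "(\<Sum>k<m + j. D k \<omega>) = (\<Sum>k<m. D k \<omega>) + (\<Sum>k<j. D (m + k) \<omega>)" for m j
      by (induction j) auto
    have "Cauchy (\<lambda>n. \<Sum>k<n. D k \<omega>)"
      unfolding Cauchy_altdef2
    proof (intro allI impI)
      fix e :: real assume "0 < e"
      then obtain r where r: "1 / real (Suc r) < e"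
        using nat_approx_posE by metis
      obtain m where "\<omega> \<notin> A (1 / real (Suc r)) m"
        using elim by blast
      with elim have m: "\<bar>\<Sum>k<j. D (m + k) \<omega>\<bar> < 1 / real (Suc r)" for j
        by (auto simp: A_def not_le)
      have "dist (\<Sum>k<n. D k \<omega>) (\<Sum>k<m. D k \<omega>) < e" if "m \<le> n" for n
        using split[of m "n - m"] m[of "n - m"] r that by (simp add: dist_real_def)
      then show "\<exists>m. \<forall>n\<ge>m. dist (\<Sum>k<n. D k \<omega>) (\<Sum>k<m. D k \<omega>) < e" by blast
    qed
    then show ?case by (rule Cauchy_convergent)
  qed
qed

end

section \<open>The urn process\<close>

lemma pmf_edge_choice:
  fixes I :: "'v::finite set"
  assumes "I \<noteq> {}" "\<And>i. 1 \<le> b i"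
  shows "pmf (edge_choice b I) i = (if i \<in> I then real (b i) / real (sum b I) else 0)"
  proof -
  let ?A = "\<Sum>i\<in>I. replicate_mset (b i) i"
  have size: "size ?A = sum b I"
    by (simp add: size_multiset_sum)
  have "0 < sum b I"
    using assms by (intro sum_pos) (auto simp: Suc_le_eq)
  then have "?A \<noteq> {#}"
    using size by force
  moreover have "count ?A i = (if i \<in> I then b i else 0)"
    by (simp add: count_sum)
  ultimately show ?thesis
    unfolding edge_choice_def using size by (simp add: pmf_of_multiset)
qed

lemma finite_set_pmf_urn_step: "finite (set_pmf (urn_step E b))"
  by (simp add: urn_step_def)

lemma set_pmf_urn_step:
  assumes "s \<in> set_pmf (urn_step E b)"
  shows "b i \<le> s i" "s i \<le> b i + card E" "sum s UNIV = sum b UNIV + card E"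
proof -
  obtain f where s: "s = (\<lambda>i. b i + card {I \<in> E. f I = i})"
    using assms by (auto simp: urn_step_def)
  show "b i \<le> s i" "s i \<le> b i + card E"
    by (auto simp: s intro: card_mono)
  \<comment> \<open>Double counting: every edge sends its ball to exactly one vertex.\<close>
  have "(\<Sum>i\<in>UNIV. card {I \<in> E. f I = i}) = (\<Sum>i\<in>UNIV. \<Sum>I\<in>E. if f I = i then 1 else 0)"
    by (simp add: sum.If_cases Int_def)
  also have "\<dots> = card E"
    by (subst sum.swap) simp
  finally show "sum s UNIV = sum b UNIV + card E"
    by (simp add: s sum.distrib)
qed

text \<open>The balls added to \<open>i\<close> are a sum of indicators over the edges, so linearity
  reduces to the marginal laws \<open>edge_choice b I\<close>. Factoring out \<open>b i\<close>
  prepares division by it.\<close>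

lemma expectation_urn_step:
  assumes "\<forall>I\<in>E. I \<noteq> {}" "\<And>i. 1 \<le> b i"
  shows "measure_pmf.expectation (urn_step E b) (\<lambda>s. real (s i) - real (b i))
    = real (b i) * (\<Sum>I | I \<in> E \<and> i \<in> I. 1 / real (sum b I))"
proof -
  let ?P = "Pi_pmf E undefined (edge_choice b)"
  have "measure_pmf.expectation (urn_step E b) (\<lambda>s. real (s i) - real (b i))
      = measure_pmf.expectation ?P (\<lambda>f. real (card {I \<in> E. f I = i}))"
    by (simp add: urn_step_def)
  also have "\<dots> = measure_pmf.expectation ?P (\<lambda>f. \<Sum>I\<in>E. indicator {i} (f I))"
    by (intro Bochner_Integration.integral_cong refl)
       (simp add: indicator_def sum.If_cases Int_def)
  also have "\<dots> = (\<Sum>I\<in>E. measure_pmf.expectation ?P (\<lambda>f. indicator {i} (f I)))"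
    by (intro Bochner_Integration.integral_sum integrable_measure_pmf_finite) simp
  also have "\<dots> = (\<Sum>I\<in>E. pmf (edge_choice b I) i)"
  proof (intro sum.cong refl)
    fix I assume "I \<in> E"
    then have comp: "map_pmf (\<lambda>f. f I) ?P = edge_choice b I"
      by (simp add: Pi_pmf_component)
    have "measure_pmf.expectation ?P (\<lambda>f. indicat_real {i} (f I))
        = measure_pmf.expectation (map_pmf (\<lambda>f. f I) ?P) (indicator {i})"
      unfolding integral_map_pmf ..
    then show "measure_pmf.expectation ?P (\<lambda>f. indicator {i} (f I)) = pmf (edge_choice b I) i"
      unfolding comp by (simp add: measure_pmf_single)
  qed
  also have "\<dots> = (\<Sum>I\<in>E. if i \<in> I then real (b i) / real (sum b I) else 0)"
    using assms by (intro sum.cong refl pmf_edge_choice) auto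
  also have "\<dots> = real (b i) * (\<Sum>I | I \<in> E \<and> i \<in> I. 1 / real (sum b I))"
    by (simp add: sum_distrib_left sum.If_cases Int_def)
  finally show ?thesis .
qed

section \<open>Histories and the Markov property\<close>

locale urn = prob_space M for M :: "'w measure" +
  fixes E :: "'v::finite set set" and B :: "nat \<Rightarrow> 'w \<Rightarrow> 'v \<Rightarrow> nat" and b0 :: "'v \<Rightarrow> nat"
  assumes nonempty: "\<forall>I\<in>E. I \<noteq> {}"
    and initial: "\<And>i. 1 \<le> b0 i"
    and process: "urn_process E b0 M B"
begin

text \<open>Times 0 to \<open>n\<close> inclusive: the last entry is the current state, and
  \<open>butlast\<close> recovers the previous history.\<close>

definition hist :: "nat \<Rightarrow> 'w \<Rightarrow> ('v \<Rightarrow> nat) list" where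
  "hist n \<omega> = map (\<lambda>k. B k \<omega>) [0..<Suc n]"

text \<open>The histories allowed by the transition law. There are finitely many, which reduces
  expectations to finite sums.\<close>

primrec reachable :: "nat \<Rightarrow> ('v \<Rightarrow> nat) list set" where
  "reachable 0 = {[b0]}"
| "reachable (Suc n) = (\<Union>h\<in>reachable n. (\<lambda>s. h @ [s]) ` set_pmf (urn_step E (last h)))"

lemma hist_Suc: "hist (Suc n) \<omega> = hist n \<omega> @ [B (Suc n) \<omega>]"
  by (simp add: hist_def)

lemma length_hist [simp]: "length (hist n \<omega>) = Suc n"
  by (simp add: hist_def)

lemma last_hist [simp]: "last (hist n \<omega>) = B n \<omega>"
  by (simp add: hist_def)

lemma hist_eq_iff: "length h = Suc n \<Longrightarrow> hist n \<omega> = h \<longleftrightarrow> (\<forall>k\<le>n. B k \<omega> = h ! k)"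
  by (auto simp: hist_def list_eq_iff_nth_eq less_Suc_eq_le simp del: upt_Suc)

lemma finite_reachable: "finite (reachable n)"
  by (induction n) (auto intro: finite_set_pmf_urn_step)

lemma reachable_pos: "h \<in> reachable n \<Longrightarrow> length h = Suc n \<and> (\<forall>i. 1 \<le> last h i)"
proof (induction n arbitrary: h)
  case 0
  then show ?case using initial by simp
next
  case (Suc n)
  then show ?case using set_pmf_urn_step(1) order_trans by fastforce
qed

lemma measurable_B [measurable]: "B n \<in> measurable M (count_space UNIV)"
  using process by (simp add: urn_process_def)

lemma measurable_hist [measurable]: "hist n \<in> measurable M (count_space UNIV)"
proof (induction n)
  case 0
  show ?case unfolding hist_def by simp
next
  case (Suc n)
  have "(\<lambda>\<omega>. hist n \<omega> @ [B (Suc n) \<omega>]) \<in> measurable M (count_space UNIV)"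
    by (rule measurable_compose_countable[OF _ Suc]) simp
  then show ?case by (simp add: hist_Suc cong: measurable_cong)
qed

lemma prob_step:
  assumes "length h = Suc n"
  shows "prob {\<omega>\<in>space M. hist n \<omega> = h \<and> B (Suc n) \<omega> = s}
    = prob {\<omega>\<in>space M. hist n \<omega> = h} * pmf (urn_step E (last h)) s"
proof -
  have "last h = h ! n" using assms by (subst last_conv_nth) auto
  then show ?thesis
    using process assms by (simp add: urn_process_def hist_eq_iff)
qed

text \<open>Each forbidden pair of a history and a next state is null, and there are countably many
  such pairs.\<close>

lemma AE_step: "AE \<omega> in M. \<forall>n. B (Suc n) \<omega> \<in> set_pmf (urn_step E (B n \<omega>))"
proof -
  have "AE \<omega> in M. \<not> (hist n \<omega> = h \<and> B (Suc n) \<omega> = s)"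
    if "s \<notin> set_pmf (urn_step E (last h))" for n h s
  proof (cases "length h = Suc n")
    case True
    have "prob {\<omega>\<in>space M. hist n \<omega> = h \<and> B (Suc n) \<omega> = s} = 0"
      using that by (simp add: prob_step[OF True] set_pmf_iff)
    then show ?thesis
      by (subst (asm) prob_eq_0) (auto elim!: eventually_mono)
  next
    case False
    then show ?thesis by auto
  qed
  then have "AE \<omega> in M. \<forall>n h s. s \<notin> set_pmf (urn_step E (last h))
      \<longrightarrow> \<not> (hist n \<omega> = h \<and> B (Suc n) \<omega> = s)"
    unfolding AE_all_countable by auto
  then show ?thesis
    by eventually_elim (metis last_hist)
qed

lemma AE_path:
  "AE \<omega> in M. B 0 \<omega> = b0 \<and> (\<forall>n. B (Suc n) \<omega> \<in> set_pmf (urn_step E (B n \<omega>)))"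
  using AE_space AE_step by eventually_elim (use process in \<open>auto simp: urn_process_def\<close>)

lemma AE_reachable: "AE \<omega> in M. \<forall>n. hist n \<omega> \<in> reachable n"
  using AE_path
proof eventually_elim
  case (elim \<omega>)
  have "hist n \<omega> \<in> reachable n" for n
  proof (induction n)
    case 0
    then show ?case using elim by (simp add: hist_def)
  next
    case (Suc n)
    with elim show ?case
      by (auto simp: hist_Suc intro!: bexI[of _ "hist n \<omega>"])
  qed
  then show ?case by blast
qed

text \<open>Almost surely the history takes finitely many values, so every function of it is
  essentially bounded.\<close>

lemma integrable_hist: "integrable M (\<lambda>\<omega>. g (hist n \<omega>))" for g :: "_ \<Rightarrow> real"
proof (rule integrable_const_bound)
  show "AE \<omega> in M. norm (g (hist n \<omega>)) \<le> (\<Sum>h\<in>reachable n. norm (g h))"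
    using AE_reachable
  proof eventually_elim
    case (elim \<omega>)
    then show ?case
      by (intro member_le_sum[of "hist n \<omega>" _ "\<lambda>h. norm (g h)"] finite_reachable) auto
  qed
  show "(\<lambda>\<omega>. g (hist n \<omega>)) \<in> borel_measurable M"
    by (rule measurable_compose[OF measurable_hist]) simp
qed

text \<open>The tower property: split by history and next state, apply \<open>prob_step\<close> to
  each cell, and sum over the next state first.\<close>

lemma expectation_step:
  fixes F :: "('v \<Rightarrow> nat) list \<Rightarrow> ('v \<Rightarrow> nat) \<Rightarrow> real"
  shows "expectation (\<lambda>\<omega>. F (hist n \<omega>) (B (Suc n) \<omega>))
    = expectation (\<lambda>\<omega>. measure_pmf.expectation (urn_step E (B n \<omega>)) (F (hist n \<omega>)))"
proof -
  define S where "S h = set_pmf (urn_step E (last h))" for h :: "('v \<Rightarrow> nat) list"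
  define C where "C h = {\<omega>\<in>space M. hist n \<omega> = h}" for h
  define C' where "C' h s = {\<omega>\<in>space M. hist n \<omega> = h \<and> B (Suc n) \<omega> = s}" for h s
  have [measurable]: "C h \<in> events" "C' h s \<in> events" for h s
    unfolding C_def C'_def by measurable
  have int: "integrable M (\<lambda>\<omega>. c * indicator (C h) \<omega>)" "integrable M (\<lambda>\<omega>. c * indicator (C' h s) \<omega>)"
    for c :: real and h s
    by (intro integrable_mult_right integrable_real_indicator; simp add: less_top[symmetric])+
  have finS: "finite (S h)" for h
    unfolding S_def by (rule finite_set_pmf_urn_step)
  \<comment> \<open>Almost surely exactly one pair of indices matches the path.\<close>
  have "AE \<omega> in M. F (hist n \<omega>) (B (Suc n) \<omega>)
      = (\<Sum>h\<in>reachable n. \<Sum>s\<in>S h. F h s * indicator (C' h s) \<omega>)"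
    using AE_space AE_reachable AE_step
  proof eventually_elim
    case (elim \<omega>)
    have "(\<Sum>h\<in>reachable n. \<Sum>s\<in>S h. F h s * indicator (C' h s) \<omega>)
        = (\<Sum>h\<in>reachable n. if h = hist n \<omega> then \<Sum>s\<in>S h. if s = B (Suc n) \<omega> then F h s else 0 else 0)"
      using elim(1) by (intro sum.cong refl) (auto simp: C'_def indicator_def intro!: sum.cong)
    also have "\<dots> = F (hist n \<omega>) (B (Suc n) \<omega>)"
      using elim(2,3) by (simp add: finite_reachable finite_set_pmf_urn_step S_def)
    finally show ?case by simp
  qed
  then have "expectation (\<lambda>\<omega>. F (hist n \<omega>) (B (Suc n) \<omega>))
      = expectation (\<lambda>\<omega>. \<Sum>h\<in>reachable n. \<Sum>s\<in>S h. F h s * indicator (C' h s) \<omega>)"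
  proof (intro integral_cong_AE)
    show "(\<lambda>\<omega>. F (hist n \<omega>) (B (Suc n) \<omega>)) \<in> borel_measurable M"
      using borel_measurable_integrable[OF integrable_hist[of "\<lambda>h. F (butlast h) (last h)" "Suc n"]]
      by (simp add: hist_Suc)
  qed measurable
  also have "\<dots> = (\<Sum>h\<in>reachable n. \<Sum>s\<in>S h. F h s * prob (C' h s))"
  proof -
    have "expectation (\<lambda>\<omega>. \<Sum>h\<in>reachable n. \<Sum>s\<in>S h. F h s * indicator (C' h s) \<omega>)
        = (\<Sum>h\<in>reachable n. expectation (\<lambda>\<omega>. \<Sum>s\<in>S h. F h s * indicator (C' h s) \<omega>))"
      by (intro Bochner_Integration.integral_sum Bochner_Integration.integrable_sum int)
    also have "\<dots> = (\<Sum>h\<in>reachable n. \<Sum>s\<in>S h. expectation (\<lambda>\<omega>. F h s * indicator (C' h s) \<omega>))"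
      by (intro sum.cong refl Bochner_Integration.integral_sum int)
    finally show ?thesis by simp
  qed
  also have "\<dots> = (\<Sum>h\<in>reachable n. \<Sum>s\<in>S h. F h s * (prob (C h) * pmf (urn_step E (last h)) s))"
    unfolding C'_def C_def by (intro sum.cong refl) (simp add: prob_step reachable_pos)
  also have "\<dots> = (\<Sum>h\<in>reachable n. prob (C h) * measure_pmf.expectation (urn_step E (last h)) (F h))"
  proof (intro sum.cong refl)
    fix h
    show "(\<Sum>s\<in>S h. F h s * (prob (C h) * pmf (urn_step E (last h)) s))
        = prob (C h) * measure_pmf.expectation (urn_step E (last h)) (F h)"
      by (subst integral_measure_pmf_real[OF finS])
         (auto simp: S_def sum_distrib_left intro!: sum.cong)
  qed
  also have "\<dots> = expectation (\<lambda>\<omega>. \<Sum>h\<in>reachable n.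
      measure_pmf.expectation (urn_step E (last h)) (F h) * indicator (C h) \<omega>)"
    by (subst Bochner_Integration.integral_sum, rule int) (simp add: mult.commute)
  also have "\<dots> = expectation (\<lambda>\<omega>. measure_pmf.expectation (urn_step E (B n \<omega>)) (F (hist n \<omega>)))"
  proof (rule integral_cong_AE)
    show "(\<lambda>\<omega>. measure_pmf.expectation (urn_step E (B n \<omega>)) (F (hist n \<omega>))) \<in> borel_measurable M"
      using borel_measurable_integrable[OF integrable_hist[of
          "\<lambda>h. measure_pmf.expectation (urn_step E (last h)) (F h)" n]] by simp
    show "AE \<omega> in M. (\<Sum>h\<in>reachable n.
          measure_pmf.expectation (urn_step E (last h)) (F h) * indicator (C h) \<omega>)
        = measure_pmf.expectation (urn_step E (B n \<omega>)) (F (hist n \<omega>))"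
      using AE_space AE_reachable
    proof eventually_elim
      case (elim \<omega>)
      have "(\<Sum>h\<in>reachable n. measure_pmf.expectation (urn_step E (last h)) (F h) * indicator (C h) \<omega>)
          = (\<Sum>h\<in>reachable n. if h = hist n \<omega> then measure_pmf.expectation (urn_step E (last h)) (F h) else 0)"
        using elim(1) by (intro sum.cong refl) (auto simp: C_def indicator_def)
      also have "\<dots> = measure_pmf.expectation (urn_step E (B n \<omega>)) (F (hist n \<omega>))"
        using elim(2) by (simp add: finite_reachable sum.delta)
      finally show ?case .
    qed
  qed measurable
  finally show ?thesis .
qed

section \<open>The noise martingale and its convergence\<close>

text \<open>The conditional mean of the relative increment of \<open>i\<close>: dividing by
  \<open>b i\<close> cancels the numerator of each choice probability.\<close>

definition drift :: "('v \<Rightarrow> nat) \<Rightarrow> 'v \<Rightarrow> real" where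
  "drift b i = (\<Sum>I | I \<in> E \<and> i \<in> I. 1 / real (sum b I))"

definition noise :: "'v \<Rightarrow> nat \<Rightarrow> 'w \<Rightarrow> real" where
  "noise i n \<omega> = (real (B (Suc n) \<omega> i) - real (B n \<omega> i)) / real (B n \<omega> i) - drift (B n \<omega>) i"

text \<open>Given the history, \<open>g (hist n \<omega>)\<close> is constant and the noise averages
  to 0 over the next step.\<close>

lemma expectation_noise: "expectation (\<lambda>\<omega>. g (hist n \<omega>) * noise i n \<omega>) = 0"
proof -
  define F where "F h s = g h * ((real (s i) - real (last h i)) / real (last h i) - drift (last h) i)"
    for h and s :: "'v \<Rightarrow> nat"
  have "expectation (\<lambda>\<omega>. g (hist n \<omega>) * noise i n \<omega>)
      = expectation (\<lambda>\<omega>. measure_pmf.expectation (urn_step E (B n \<omega>)) (F (hist n \<omega>)))"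
    unfolding expectation_step[symmetric] by (simp add: F_def noise_def)
  also have "\<dots> = expectation (\<lambda>_. 0)"
  proof (rule integral_cong_AE)
    show "(\<lambda>\<omega>. measure_pmf.expectation (urn_step E (B n \<omega>)) (F (hist n \<omega>))) \<in> borel_measurable M"
      using borel_measurable_integrable[OF integrable_hist[of
          "\<lambda>h. measure_pmf.expectation (urn_step E (last h)) (F h)" n]] by simp
    show "AE \<omega> in M. measure_pmf.expectation (urn_step E (B n \<omega>)) (F (hist n \<omega>)) = 0"
      using AE_reachable
    proof eventually_elim
      case (elim \<omega>)
      then have pos: "\<And>i. 1 \<le> B n \<omega> i"
        using reachable_pos[of "hist n \<omega>" n] by auto
      then have "real (B n \<omega> i) \<noteq> 0"
        by (metis not_one_le_zero of_nat_eq_0_iff)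
      have int: "integrable (measure_pmf (urn_step E (B n \<omega>))) f" for f :: "_ \<Rightarrow> real"
        by (rule integrable_measure_pmf_finite[OF finite_set_pmf_urn_step])
      have "measure_pmf.expectation (urn_step E (B n \<omega>)) (F (hist n \<omega>))
          = g (hist n \<omega>) * (measure_pmf.expectation (urn_step E (B n \<omega>))
              (\<lambda>s. real (s i) - real (B n \<omega> i)) / real (B n \<omega> i) - drift (B n \<omega>) i)"
        unfolding F_def last_hist integral_mult_right_zero integral_divide_zero[symmetric]
        by (subst Bochner_Integration.integral_diff[OF int int]) simp
      also have "\<dots> = 0"
        using expectation_urn_step[of E "B n \<omega>" i, OF nonempty pos] \<open>real (B n \<omega> i) \<noteq> 0\<close>
        by (simp add: drift_def)
      finally show ?case .
    qed
  qed simp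
  finally show ?thesis by simp
qed

lemma AE_bounded_path:
  "AE \<omega> in M. B 0 \<omega> = b0 \<and> (\<forall>n i. B n \<omega> i \<le> B (Suc n) \<omega> i \<and> B (Suc n) \<omega> i \<le> B n \<omega> i + card E) \<and>
     (\<forall>n. sum (B n \<omega>) UNIV = sum b0 UNIV + n * card E)"
  using AE_path
proof eventually_elim
  case (elim \<omega>)
  have "sum (B n \<omega>) UNIV = sum b0 UNIV + n * card E" for n
  proof (induction n)
    case (Suc n)
    with elim show ?case using set_pmf_urn_step(3)[of "B (Suc n) \<omega>" E "B n \<omega>"] by simp
  qed (use elim in simp)
  with elim show ?case using set_pmf_urn_step(1,2) by blast
qed

text \<open>Centering does not increase second moments, and the squared relative increments have a
  pathwise bounded sum; so the variances are summable.\<close>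

lemma AE_convergent_noise: "AE \<omega> in M. convergent (\<lambda>n. \<Sum>k<n. noise i k \<omega>)"
proof -
  define G where "G h = (real (last h i) - real (last (butlast h) i)) / real (last (butlast h) i)
      - drift (last (butlast h)) i" for h
  have hist_noise: "noise i n \<omega> = G (hist (Suc n) \<omega>)" for n \<omega>
    by (simp add: hist_Suc noise_def G_def)
  interpret history_martingale M hist "noise i"
  proof
    show "\<exists>d. \<forall>\<omega>. noise i n \<omega> = d (hist (Suc n) \<omega>)" for n
      using hist_noise by blast
    show "\<exists>\<pi>. \<forall>\<omega>. hist n \<omega> = \<pi> (hist (Suc n) \<omega>)" for n
      by (rule exI[of _ butlast]) (simp add: hist_Suc)
  qed (fact integrable_hist expectation_noise)+
  define X where "X n \<omega> = (real (B (Suc n) \<omega> i) - real (B n \<omega> i)) / real (B n \<omega> i)" for n \<omega>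
  have int_X: "integrable M (\<lambda>\<omega>. (X n \<omega>)\<^sup>2)" for n
    using integrable_hist[of "\<lambda>h. ((real (last h i) - real (last (butlast h) i))
      / real (last (butlast h) i))\<^sup>2" "Suc n"] by (simp add: hist_Suc X_def)
  have var: "expectation (\<lambda>\<omega>. (noise i n \<omega>)\<^sup>2) \<le> expectation (\<lambda>\<omega>. (X n \<omega>)\<^sup>2)" for n
  proof -
    \<comment> \<open>Expand the square of \<open>X = noise + drift\<close> and drop the squared
      drift; the mixed term has mean 0.\<close>
    have "(noise i n \<omega>)\<^sup>2 \<le> (X n \<omega>)\<^sup>2 - 2 * (drift (B n \<omega>) i * noise i n \<omega>)" for \<omega>
      by (simp add: noise_def X_def power2_eq_square algebra_simps)
    moreover have int: "integrable M (\<lambda>\<omega>. drift (B n \<omega>) i * noise i n \<omega>)"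
      using integrable_hist[of "\<lambda>h. drift (last (butlast h)) i * G h" "Suc n"]
      unfolding hist_noise[symmetric] by (simp add: hist_Suc)
    ultimately have "expectation (\<lambda>\<omega>. (noise i n \<omega>)\<^sup>2)
        \<le> expectation (\<lambda>\<omega>. (X n \<omega>)\<^sup>2 - 2 * (drift (B n \<omega>) i * noise i n \<omega>))"
      by (intro integral_mono integrable_increment_sq) (auto intro: int_X)
    also have "\<dots> = expectation (\<lambda>\<omega>. (X n \<omega>)\<^sup>2)"
      using int int_X expectation_noise[of "\<lambda>h. drift (last h) i" n i] by simp
    finally show ?thesis .
  qed
  have "(\<Sum>k<n. expectation (\<lambda>\<omega>. (noise i k \<omega>)\<^sup>2)) \<le> real (card E) * (real (card E) + 1)" for n
  proof -
    have "(\<Sum>k<n. expectation (\<lambda>\<omega>. (noise i k \<omega>)\<^sup>2)) \<le> expectation (\<lambda>\<omega>. \<Sum>k<n. (X k \<omega>)\<^sup>2)"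
      using int_X var by (simp add: Bochner_Integration.integral_sum sum_mono)
    also have "\<dots> \<le> expectation (\<lambda>_. real (card E) * (real (card E) + 1))"
    proof (rule integral_mono_AE)
      show "AE \<omega> in M. (\<Sum>k<n. (X k \<omega>)\<^sup>2) \<le> real (card E) * (real (card E) + 1)"
        using AE_bounded_path
      proof eventually_elim
        case (elim \<omega>)
        show ?case
          unfolding X_def
        proof (rule sum_square_relative_increments_le)
          show "real (B (Suc k) \<omega> i) \<le> real (B k \<omega> i) + real (card E)" for k
            using elim by (metis of_nat_add of_nat_le_iff)
        qed (use elim initial in auto)
      qed
    qed (use int_X in auto)
    finally show ?thesis by (simp add: prob_space)
  qed
  then show ?thesis
    by (intro AE_convergent_increment_sums summableI_nonneg_bounded) auto
qed

lemma AE_converges: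
  assumes "\<Union>E = UNIV"
  shows "AE \<omega> in M. \<exists>p\<in>maximizers E. urn_x E b0 B \<omega> \<longlonglongrightarrow> p"
proof -
  have "AE \<omega> in M. \<forall>i. convergent (\<lambda>n. \<Sum>k<n. noise i k \<omega>)"
    using AE_convergent_noise by (simp add: AE_all_countable)
  with AE_bounded_path show ?thesis
  proof eventually_elim
    case (elim \<omega>)
    then have "\<exists>p\<in>maximizers E. (\<lambda>n. \<chi> i. real (B n \<omega> i) /
        (real (sum (B 0 \<omega>) UNIV) + real n * real (card E))) \<longlonglongrightarrow> p"
      using initial by (intro urn_path_converges nonempty assms) (auto simp: noise_def drift_def)
    with elim show ?case
      by (simp add: urn_x_def[abs_def])
  qed
qed

end

lemma limit_set_subset:
  fixes f :: "nat \<Rightarrow> 'a::t2_space"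
  assumes "f \<longlonglongrightarrow> p"
  shows "limit_set f \<subseteq> {p}"
  unfolding limit_set_def using LIMSEQ_subseq_LIMSEQ[OF assms] LIMSEQ_unique by blast

theorem theorem2:
  fixes E :: "'v::finite set set"
  assumes "\<forall>I\<in>E. I \<noteq> {}"
    and "\<Union>E = UNIV"
  shows "\<exists>J :: (real ^ 'v) set.
     closed J \<and> connected J \<and> J \<subseteq> std_simplex \<and> (\<exists>A. affine A \<and> J \<subseteq> A) \<and>
     (\<forall>(M :: 'w measure) B b0. (\<forall>i. 1 \<le> b0 i) \<and> urn_process E b0 M B \<longrightarrow>
        (AE \<omega> in M. limit_set (urn_x E b0 B \<omega>) \<subseteq> J) \<and>
        ((AE \<omega> in M. limit_set (urn_x E b0 B \<omega>) \<inter> simplex_boundary = {}) \<longrightarrow>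
           (AE \<omega> in M. \<exists>p\<in>J. urn_x E b0 B \<omega> \<longlonglongrightarrow> p)))"
\<comment> \<open>The set depends on the hypergraph alone, so it is fixed before the probability
  space, the process and the initial configuration.\<close>
proof (rule exI[of _ "maximizers E"], intro conjI allI impI)
  show "closed (maximizers E)" "connected (maximizers E)" "maximizers E \<subseteq> std_simplex"
    using closed_maximizers connected_maximizers assms(1) by (auto simp: maximizers_def)
  obtain p where "p \<in> maximizers E"
    using maximizers_nonempty[OF assms(1)] by blast
  from maximizers_eq[OF assms(1) this]
  have "maximizers E \<subseteq> (\<Inter>I\<in>E. {x. (\<Sum>i\<in>I. x $ i) = (\<Sum>i\<in>I. p $ i)})"
    by simp
  then show "\<exists>A. affine A \<and> maximizers E \<subseteq> A"
    using affine_edge_constraints by blast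
next
  fix M :: "'w measure" and B b0
  assume "(\<forall>i. 1 \<le> b0 i) \<and> urn_process E b0 M B"
  then interpret urn M E B b0
    using assms(1) by (auto simp: urn_def urn_axioms_def urn_process_def)
  show conv: "AE \<omega> in M. \<exists>p\<in>maximizers E. urn_x E b0 B \<omega> \<longlonglongrightarrow> p"
    using AE_converges[OF assms(2)] .
  \<comment> \<open>A convergent sequence has its limit as only accumulation point.\<close>
  from conv show "AE \<omega> in M. limit_set (urn_x E b0 B \<omega>) \<subseteq> maximizers E"
    by eventually_elim (auto dest: limit_set_subset)
qed

end
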